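(* Let $\varphi(s,v)=\vec c(s)+v\,\vec q(s)$ be a developable spacelike ruled surface in Minkowski 3-space $\mathbb{R}^3_1$ with striction curve $\vec c$ parametrized by arc length $s$, and let the timelike ruled surface $\varphi^*(s,v)=\vec c^{\,*}(s)+v\,\vec q^{\,*}(s)$, $\vec c^{\,*}=\vec c+R\,\vec a$, be a Mannheim offset of $\varphi$. Let $\theta$ be the angle function between $\vec q^{\,*}$ and $\vec q$, $s_1$ the arc length of the spherical image of $\vec q$, and $\kappa$ the conical curvature of $\varphi$. Then $\varphi^*$ is developable if and only if the following equality holds (for all $s$): (i) $\cosh\theta-R\,\kappa\,\dfrac{ds_1}{ds}\,\sinh\theta=0$, if $\varphi^*$ is of type $N_-$; (ii) $\sinh\theta-R\,\kappa\,\dfrac{ds_1}{ds}\,\cosh\theta=0$, if $\varphi^*$ is of type $N_+$.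
   Context: Minkowski 3-space $\mathbb{R}^3_1$ is $\mathbb{R}^3$ with the metric $\langle x,y\rangle=-x_1y_1+x_2y_2+x_3y_3$; a vector $x$ is spacelike if $\langle x,x\rangle>0$ or $x=0$, timelike if $\langle x,x\rangle<0$, null if $\langle x,x\rangle=0$ and $x\ne0$; $\|x\|=\sqrt{|\langle x,x\rangle|}$. All curves and functions are smooth on an open interval. Ruled surface: $\varphi(s,v)=\vec c(s)+v\,\vec q(s)$ with $\langle\vec q,\vec q\rangle=\pm1$ and $d\vec q/ds$ non-null and nonzero everywhere. The base curve $\vec c$ is the striction curve if $\langle d\vec c/ds,d\vec q/ds\rangle=0$; this is assumed for all base curves denoted $\vec c,\vec c^{\,*}$. The surface is developable if its distribution parameter $\delta=\det(\vec c\,',\vec q,\vec q\,')/\langle \vec q\,',\vec q\,'\rangle$ vanishes identically. For a developable ruled surface the ruling is tangent to the striction curve; for the developable spacelike surface $\varphi$ the parameter $s$ is the arc length of $\vec c$, oriented so that $d\vec c/ds=\vec q$. Frenet frame: $\vec q$ is the ruling, $\vec h=\frac{d\vec q/ds}{\|d\vec q/ds\|}$ the central normal vector, and $\vec a$ the asymptotic normal vector, i.e. the unit vector orthogonal to $\vec q$ and $\vec h$ (in the direction of $\pm\,\vec q\times\vec h$). The central normal and the asymptotic normal of a ruling are the lines through the striction point $\vec c(s)$ with directions $\vec h(s)$ and $\vec a(s)$, respectively. Types: the surface is of type $N_-$ if $\vec h$ is spacelike and $\vec q$ is timelike (so $\vec a$ is spacelike); of type $N_+$ if $\vec h$ and $\vec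 q$ are both spacelike (so $\vec a$ is timelike). Both are timelike surfaces. A spacelike ruled surface here means one of type $N_\times$: $\vec h$ is timelike and $\vec q$ is spacelike (so $\vec a$ is spacelike). For a spacelike ruled surface (type $N_\times$), $s_1$ denotes the arc length of the spherical curve $\vec q(s)$, so $ds_1/ds=\|d\vec q/ds\|$, and the conical curvature $\kappa$ is defined by the Frenet formulas $d\vec q/ds_1=\vec h$, $d\vec h/ds_1=\vec q+\kappa\vec a$, $d\vec a/ds_1=\kappa\vec h$. Mannheim offset: a ruled surface $\varphi^*$ with striction curve $\vec c^{\,*}$ and Frenet frame $\{\vec q^{\,*},\vec h^*,\vec a^*\}$ is a Mannheim offset of the spacelike ruled surface $\varphi$ if there is a one-to-one correspondence between their rulings (same parameter $s$) such that the asymptotic normal of $\varphi$ is the central normal of $\varphi^*$. With suitable orientations this means $\vec h^*=\vec a$ and $\vec c^{\,*}(s)=\vec c(s)+R(s)\vec a(s)$ for a function $R$. A Mannheim offset of a spacelike ruled surface is timelike of type $N_-$ or $N_+$, and (with suitable orientations) the angle function $\theta=\theta(s)$ is defined by: $\vec q^{\,*}=\sinh\theta\,\vec q+\cosh\theta\,\vec h$, $\vec a^*=\cosh\theta\,\vec q+\sinh\theta\,\vec h$ if $\varphi^*$ is of type $N_-$; $\vec q^{\,*}=\cosh\theta\,\vec q+\sinh\theta\,\vec h$, $\vec a^*=\sinh\theta\,\vec q+\cosh\theta\,\vec h$ if $\varphi^*$ is of type $N_+$. *)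

theory Defs
  imports "HOL-Analysis.Analysis"
begin

section \<open>Minkowski 3-space\<close>

definition mink :: "real ^ 3 \<Rightarrow> real ^ 3 \<Rightarrow> real" where
  "mink x y = - (x $ 1 * y $ 1) + x $ 2 * y $ 2 + x $ 3 * y $ 3"

definition spacelike :: "real ^ 3 \<Rightarrow> bool" where
  "spacelike x \<longleftrightarrow> mink x x > 0 \<or> x = 0"

definition timelike :: "real ^ 3 \<Rightarrow> bool" where
  "timelike x \<longleftrightarrow> mink x x < 0"

definition null_vec :: "real ^ 3 \<Rightarrow> bool" where
  "null_vec x \<longleftrightarrow> mink x x = 0 \<and> x \<noteq> 0"

definition mnorm :: "real ^ 3 \<Rightarrow> real" where
  "mnorm x = sqrt \<bar>mink x x\<bar>"

definition det3 :: "real ^ 3 \<Rightarrow> real ^ 3 \<Rightarrow> real ^ 3 \<Rightarrow> real" where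
  "det3 x y z = det (vector [x, y, z] :: real ^ 3 ^ 3)"


section \<open>Smooth curves on an open interval\<close>

definition open_interval :: "real set \<Rightarrow> bool" where
  "open_interval I \<longleftrightarrow> open I \<and> is_interval I \<and> I \<noteq> {}"

definition D :: "(real \<Rightarrow> 'a::real_normed_vector) \<Rightarrow> real \<Rightarrow> 'a" where
  "D f s = vector_derivative f (at s)"

text \<open>Infinitely differentiable; the definition is meant for open \<open>I\<close>, where the
  two-sided derivatives in \<open>D\<close> depend only on the values on \<open>I\<close>.\<close>

definition smooth_on :: "real set \<Rightarrow> (real \<Rightarrow> 'a::real_normed_vector) \<Rightarrow> bool" where
  "smooth_on I f \<longleftrightarrow> (\<forall>n. \<forall>s\<in>I. (D ^^ n) f differentiable (at s))"


section \<open>Ruled surfaces\<close>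

text \<open>The ruled surface \<open>(s, v) \<mapsto> c s + v *\<^sub>R q s\<close>, with \<open>s\<close> in \<open>I\<close>, is given by its base
  curve \<open>c\<close> and its director curve \<open>q\<close>. As for every ruled surface considered here, the base
  curve is the striction curve.\<close>

definition striction_curve ::
    "real set \<Rightarrow> (real \<Rightarrow> real ^ 3) \<Rightarrow> (real \<Rightarrow> real ^ 3) \<Rightarrow> bool" where
  "striction_curve I c q \<longleftrightarrow> (\<forall>s\<in>I. mink (D c s) (D q s) = 0)"

definition ruled_surface ::
    "real set \<Rightarrow> (real \<Rightarrow> real ^ 3) \<Rightarrow> (real \<Rightarrow> real ^ 3) \<Rightarrow> bool" where
  "ruled_surface I c q \<longleftrightarrow>
     open_interval I \<and> smooth_on I c \<and> smooth_on I q \<and>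
     (\<forall>s\<in>I. mink (q s) (q s) = 1 \<or> mink (q s) (q s) = - 1) \<and>
     (\<forall>s\<in>I. \<not> null_vec (D q s) \<and> D q s \<noteq> 0) \<and>
     striction_curve I c q"

definition distribution_parameter ::
    "(real \<Rightarrow> real ^ 3) \<Rightarrow> (real \<Rightarrow> real ^ 3) \<Rightarrow> real \<Rightarrow> real" where
  "distribution_parameter c q s = det3 (D c s) (q s) (D q s) / mink (D q s) (D q s)"

definition developable ::
    "real set \<Rightarrow> (real \<Rightarrow> real ^ 3) \<Rightarrow> (real \<Rightarrow> real ^ 3) \<Rightarrow> bool" where
  "developable I c q \<longleftrightarrow> (\<forall>s\<in>I. distribution_parameter c q s = 0)"

definition arc_length_param :: "real set \<Rightarrow> (real \<Rightarrow> real ^ 3) \<Rightarrow> bool" where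
  "arc_length_param I c \<longleftrightarrow> (\<forall>s\<in>I. mnorm (D c s) = 1)"

text \<open>The asymptotic normal \<open>a\<close> is determined by \<open>q\<close> and \<open>h\<close> only up to sign; either
  (smooth) choice of the orientation is allowed.\<close>

definition frenet_frame ::
    "real set \<Rightarrow> (real \<Rightarrow> real ^ 3) \<Rightarrow> (real \<Rightarrow> real ^ 3) \<Rightarrow> (real \<Rightarrow> real ^ 3) \<Rightarrow> bool" where
  "frenet_frame I q h a \<longleftrightarrow>
     smooth_on I h \<and> smooth_on I a \<and>
     (\<forall>s\<in>I. h s = (1 / mnorm (D q s)) *\<^sub>R D q s \<and>
            mnorm (a s) = 1 \<and> mink (a s) (q s) = 0 \<and> mink (a s) (h s) = 0)"

definition type_N_minus ::
    "real set \<Rightarrow> (real \<Rightarrow> real ^ 3) \<Rightarrow> (real \<Rightarrow> real ^ 3) \<Rightarrow> bool" where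
  "type_N_minus I q h \<longleftrightarrow> (\<forall>s\<in>I. spacelike (h s) \<and> timelike (q s))"

definition type_N_plus ::
    "real set \<Rightarrow> (real \<Rightarrow> real ^ 3) \<Rightarrow> (real \<Rightarrow> real ^ 3) \<Rightarrow> bool" where
  "type_N_plus I q h \<longleftrightarrow> (\<forall>s\<in>I. spacelike (h s) \<and> spacelike (q s))"

definition type_N_times ::
    "real set \<Rightarrow> (real \<Rightarrow> real ^ 3) \<Rightarrow> (real \<Rightarrow> real ^ 3) \<Rightarrow> bool" where
  "type_N_times I q h \<longleftrightarrow> (\<forall>s\<in>I. timelike (h s) \<and> spacelike (q s))"


section \<open>Spherical arc length and conical curvature\<close>

definition spherical_arc_length ::
    "real set \<Rightarrow> (real \<Rightarrow> real ^ 3) \<Rightarrow> (real \<Rightarrow> real) \<Rightarrow> bool" where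
  "spherical_arc_length I q s1 \<longleftrightarrow>
     (\<forall>s\<in>I. (s1 has_real_derivative mnorm (D q s)) (at s))"

text \<open>\<open>df/ds\<^sub>1\<close>, evaluated at the point with parameter \<open>s\<close>: by the chain rule this is
  \<open>(df/ds) / (ds\<^sub>1/ds)\<close>.\<close>

definition D_wrt :: "(real \<Rightarrow> real) \<Rightarrow> (real \<Rightarrow> real ^ 3) \<Rightarrow> real \<Rightarrow> real ^ 3" where
  "D_wrt s1 f s = (1 / deriv s1 s) *\<^sub>R D f s"

definition conical_curvature ::
    "real set \<Rightarrow> (real \<Rightarrow> real ^ 3) \<Rightarrow> (real \<Rightarrow> real ^ 3) \<Rightarrow> (real \<Rightarrow> real ^ 3) \<Rightarrow>
     (real \<Rightarrow> real) \<Rightarrow> (real \<Rightarrow> real) \<Rightarrow> bool" where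
  "conical_curvature I q h a s1 \<kappa> \<longleftrightarrow>
     (\<forall>s\<in>I. D_wrt s1 q s = h s \<and>
            D_wrt s1 h s = q s + \<kappa> s *\<^sub>R a s \<and>
            D_wrt s1 a s = \<kappa> s *\<^sub>R h s)"


section \<open>Mannheim offsets\<close>

definition line_through :: "real ^ 3 \<Rightarrow> real ^ 3 \<Rightarrow> (real ^ 3) set" where
  "line_through p d = {p + t *\<^sub>R d | t. True}"

text \<open>Rulings with the same parameter correspond; the asymptotic normal line of the first
  surface (striction curve \<open>c\<close>, asymptotic normal vector \<open>a\<close>) is the central normal line of the
  second one (striction curve \<open>c'\<close>, central normal vector \<open>h'\<close>). Being a condition on lines, it
  permits both orientations \<open>h' = a\<close> and \<open>h' = - a\<close>.\<close>

definition mannheim_offset ::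
    "real set \<Rightarrow> (real \<Rightarrow> real ^ 3) \<Rightarrow> (real \<Rightarrow> real ^ 3) \<Rightarrow>
     (real \<Rightarrow> real ^ 3) \<Rightarrow> (real \<Rightarrow> real ^ 3) \<Rightarrow> bool" where
  "mannheim_offset I c a c' h' \<longleftrightarrow>
     (\<forall>s\<in>I. line_through (c s) (a s) = line_through (c' s) (h' s))"

definition offset_angle ::
    "real set \<Rightarrow> (real \<Rightarrow> real ^ 3) \<Rightarrow> (real \<Rightarrow> real ^ 3) \<Rightarrow>
     (real \<Rightarrow> real ^ 3) \<Rightarrow> (real \<Rightarrow> real ^ 3) \<Rightarrow> (real \<Rightarrow> real ^ 3) \<Rightarrow> (real \<Rightarrow> real) \<Rightarrow> bool" where
  "offset_angle I q h q' h' a' \<theta> \<longleftrightarrow>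
     smooth_on I \<theta> \<and>
     (type_N_minus I q' h' \<longrightarrow>
        (\<forall>s\<in>I. q' s = sinh (\<theta> s) *\<^sub>R q s + cosh (\<theta> s) *\<^sub>R h s \<and>
               a' s = cosh (\<theta> s) *\<^sub>R q s + sinh (\<theta> s) *\<^sub>R h s)) \<and>
     (type_N_plus I q' h' \<longrightarrow>
        (\<forall>s\<in>I. q' s = cosh (\<theta> s) *\<^sub>R q s + sinh (\<theta> s) *\<^sub>R h s \<and>
               a' s = sinh (\<theta> s) *\<^sub>R q s + cosh (\<theta> s) *\<^sub>R h s))"

end

theory Submission
  imports Defs
begin

text \<open>
  Everything takes place in the moving frame \<open>q, h, a\<close> of the spacelike surface. Write \<open>p\<close> for
  \<open>ds\<^sub>1/ds\<close>. Since the ruling is the unit tangent of \<open>c\<close> and \<open>da/ds = p \<kappa> h\<close>, the offset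
  striction curve has velocity \<open>q + R p \<kappa> h + (dR/ds) a\<close>. The Mannheim condition makes \<open>h'\<close>, hence
  also \<open>dq'/ds\<close>, a nonzero multiple of \<open>a\<close>. The numerator of the distribution parameter
  of the offset is therefore \<open>\<mu> det (q + R p \<kappa> h, q', a)\<close> with \<open>\<mu> \<noteq> 0\<close>; the component along \<open>a\<close>
  drops out. As \<open>q'\<close> is a combination \<open>\<sigma> q + \<tau> h\<close>, the determinant
  is \<open>(\<tau> - R \<kappa> p \<sigma>) det (q, h, a)\<close>, and \<open>det (q, h, a) \<noteq> 0\<close> because the frame is linearly independent.
  So the offset is developable exactly when \<open>\<tau> - R \<kappa> p \<sigma>\<close> vanishes identically
  (\<open>developable_offset_iff\<close>). The two types of offset differ only in
  whether \<open>(\<sigma>, \<tau>)\<close> is \<open>(sinh \<theta>, cosh \<theta>)\<close> or \<open>(cosh \<theta>, sinh \<theta>)\<close>.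
\<close>

lemma det3_expand:
  "det3 x y z = x$1 * (y$2 * z$3 - y$3 * z$2) - x$2 * (y$1 * z$3 - y$3 * z$1)
     + x$3 * (y$1 * z$2 - y$2 * z$1)"
  by (simp add: det3_def det_3 algebra_simps)

lemma det3_frame_combination:
  "det3 (\<alpha> *\<^sub>R x + \<beta> *\<^sub>R y + \<gamma> *\<^sub>R z) (\<sigma> *\<^sub>R x + \<tau> *\<^sub>R y) (\<mu> *\<^sub>R z)
     = \<mu> * (\<alpha> * \<tau> - \<beta> * \<sigma>) * det3 x y z"
  unfolding det3_expand vector_add_component vector_scaleR_component real_scaleR_def
  by algebra

text \<open>The squared determinant is, up to the sign coming from the signature of the metric, the Gram
  determinant.\<close>

lemma det3_squared_eq_gram:
  "(det3 x y z)\<^sup>2 =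
     - (mink x x * (mink y y * mink z z - mink y z * mink y z)
        - mink x y * (mink x y * mink z z - mink y z * mink x z)
        + mink x z * (mink x y * mink y z - mink y y * mink x z))"
  unfolding det3_expand mink_def by algebra

lemma mink_commute: "mink x y = mink y x"
  by (simp add: mink_def mult.commute)

lemma mnorm_nonzero_iff: "mnorm x \<noteq> 0 \<longleftrightarrow> mink x x \<noteq> 0"
  by (simp add: mnorm_def)

text \<open>A spacelike and a timelike vector span a nondegenerate plane, whatever their product: its Gram
  determinant is negative. Adding a non-null normal of that plane gives a basis.\<close>

lemma det3_frame_nonzero:
  assumes "mink x x > 0" "mink y y < 0" "mink z z \<noteq> 0" "mink z x = 0" "mink z y = 0"
  shows "det3 x y z \<noteq> 0"
proof -
  have "mink x x * mink y y < 0"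
    using assms(1,2) by (rule mult_pos_neg)
  then have "mink x x * mink y y - (mink x y)\<^sup>2 \<noteq> 0"
    using zero_le_power2[of "mink x y"] by linarith
  moreover have "(det3 x y z)\<^sup>2 = - (mink z z * (mink x x * mink y y - (mink x y)\<^sup>2))"
    unfolding det3_squared_eq_gram mink_commute[of x z] mink_commute[of y z] assms(4,5)
    by (simp add: power2_eq_square algebra_simps)
  ultimately have "(det3 x y z)\<^sup>2 \<noteq> 0"
    using assms(3) by simp
  then show ?thesis by simp
qed

lemma parallel_if_same_line:
  assumes "line_through p x = line_through p' y" "y \<noteq> 0"
  obtains t where "t \<noteq> 0" "y = t *\<^sub>R x"
proof -
  have "p' + r *\<^sub>R y \<in> line_through p x" for r
    unfolding assms(1) by (auto simp: line_through_def)
  from this[of 0] this[of 1]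
  have "\<exists>t0. p' = p + t0 *\<^sub>R x" "\<exists>t1. p' + y = p + t1 *\<^sub>R x"
    by (auto simp: line_through_def)
  then obtain t0 t1 where "p' = p + t0 *\<^sub>R x" "p' + y = p + t1 *\<^sub>R x"
    by blast
  then have "y = (t1 - t0) *\<^sub>R x"
    by (metis add_diff_cancel_left add_diff_cancel_left' scaleR_left_diff_distrib)
  then show thesis
    using that assms(2) by (metis scaleR_zero_left)
qed

lemma smooth_on_has_vector_derivative:
  assumes "smooth_on I f" "s \<in> I"
  shows "(f has_vector_derivative D f s) (at s)"
proof -
  have "(D ^^ 0) f differentiable at s"
    using assms unfolding smooth_on_def by blast
  then show ?thesis
    by (simp add: D_def vector_derivative_works)
qed

lemma D_add_scaleR:
  fixes c a c' :: "real \<Rightarrow> 'a::real_normed_vector" and R :: "real \<Rightarrow> real"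
  assumes "open I" "s \<in> I" "smooth_on I c" "smooth_on I a" "smooth_on I R"
    and "\<forall>s\<in>I. c' s = c s + R s *\<^sub>R a s"
  shows "D c' s = D c s + (R s *\<^sub>R D a s + D R s *\<^sub>R a s)"
proof -
  have "(R has_field_derivative D R s) (at s)"
    using smooth_on_has_vector_derivative[OF assms(5,2)]
    by (simp add: has_real_derivative_iff_has_vector_derivative)
  then have "((\<lambda>s. c s + R s *\<^sub>R a s) has_vector_derivative
      D c s + (R s *\<^sub>R D a s + D R s *\<^sub>R a s)) (at s)"
    using smooth_on_has_vector_derivative[OF assms(3,2)]
      smooth_on_has_vector_derivative[OF assms(4,2)]
    by (intro has_vector_derivative_add has_vector_derivative_scaleR)
  then have "(c' has_vector_derivative D c s + (R s *\<^sub>R D a s + D R s *\<^sub>R a s)) (at s)"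
    by (rule has_vector_derivative_transform_within_open[OF _ assms(1,2)])
      (simp add: assms(6))
  then show ?thesis
    unfolding D_def by (rule vector_derivative_at)
qed

lemma ruled_surface_D_director_non_null:
  assumes "ruled_surface I c q" "s \<in> I"
  shows "mink (D q s) (D q s) \<noteq> 0"
  using assms by (auto simp: ruled_surface_def null_vec_def)

lemma D_asymptotic_normal:
  assumes "ruled_surface I c q" "spherical_arc_length I q s1"
    and "conical_curvature I q h a s1 \<kappa>" "s \<in> I"
  shows "D a s = (deriv s1 s * \<kappa> s) *\<^sub>R h s"
proof -
  have "deriv s1 s = mnorm (D q s)"
    using assms(2,4) by (auto simp: spherical_arc_length_def intro: DERIV_imp_deriv)
  then have "deriv s1 s \<noteq> 0"
    using ruled_surface_D_director_non_null[OF assms(1,4)] mnorm_nonzero_iff by simp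
  moreover have "(1 / deriv s1 s) *\<^sub>R D a s = \<kappa> s *\<^sub>R h s"
    using assms(3,4) by (auto simp: conical_curvature_def D_wrt_def)
  then have "deriv s1 s *\<^sub>R (1 / deriv s1 s) *\<^sub>R D a s = (deriv s1 s * \<kappa> s) *\<^sub>R h s"
    by simp
  ultimately show ?thesis by simp
qed

lemma det3_frenet_frame_nonzero:
  assumes "ruled_surface I c q" "frenet_frame I q h a" "type_N_times I q h" "s \<in> I"
  shows "det3 (q s) (h s) (a s) \<noteq> 0"
proof (rule det3_frame_nonzero)
  have "q s \<noteq> 0"
    using assms(1,4) by (auto simp: ruled_surface_def mink_def)
  then show "mink (q s) (q s) > 0"
    using assms(3,4) by (auto simp: type_N_times_def spacelike_def)
  show "mink (h s) (h s) < 0"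
    using assms(3,4) by (auto simp: type_N_times_def timelike_def)
  have "mnorm (a s) \<noteq> 0"
    using assms(2,4) by (auto simp: frenet_frame_def)
  then show "mink (a s) (a s) \<noteq> 0"
    by (simp add: mnorm_nonzero_iff)
  show "mink (a s) (q s) = 0" "mink (a s) (h s) = 0"
    using assms(2,4) by (auto simp: frenet_frame_def)
qed

lemma mannheim_D_director:
  assumes "ruled_surface I c' q'" "frenet_frame I q' h' a'" "mannheim_offset I c a c' h'" "s \<in> I"
  obtains \<mu> where "\<mu> \<noteq> 0" "D q' s = \<mu> *\<^sub>R a s"
proof -
  have m: "mnorm (D q' s) \<noteq> 0"
    using ruled_surface_D_director_non_null[OF assms(1,4)] mnorm_nonzero_iff by simp
  have h': "h' s = (1 / mnorm (D q' s)) *\<^sub>R D q' s"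
    using assms(2,4) by (auto simp: frenet_frame_def)
  have "D q' s \<noteq> 0"
    using assms(1,4) by (auto simp: ruled_surface_def)
  then have "h' s \<noteq> 0"
    using m h' by simp
  moreover have "line_through (c s) (a s) = line_through (c' s) (h' s)"
    using assms(3,4) by (auto simp: mannheim_offset_def)
  ultimately obtain t where "t \<noteq> 0" "h' s = t *\<^sub>R a s"
    using parallel_if_same_line by metis
  moreover have "D q' s = mnorm (D q' s) *\<^sub>R h' s"
    using m h' by simp
  ultimately show thesis
    using that[of "mnorm (D q' s) * t"] m by simp
qed

text \<open>Both types of offset are instances of one criterion, in which the
  coordinates \<open>\<sigma>, \<tau>\<close> of the offset ruling are arbitrary functions.\<close>

lemma developable_offset_iff:
  fixes R \<sigma> \<tau> s1 \<kappa> :: "real \<Rightarrow> real"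
  assumes phi: "ruled_surface I c q" "frenet_frame I q h a" "type_N_times I q h"
    and tangent: "\<forall>s\<in>I. D c s = q s"
    and s1: "spherical_arc_length I q s1"
    and kappa: "conical_curvature I q h a s1 \<kappa>"
    and phi': "ruled_surface I c' q'" "frenet_frame I q' h' a'"
    and mannheim: "mannheim_offset I c a c' h'"
    and R: "smooth_on I R" "\<forall>s\<in>I. c' s = c s + R s *\<^sub>R a s"
    and q': "\<forall>s\<in>I. q' s = \<sigma> s *\<^sub>R q s + \<tau> s *\<^sub>R h s"
  shows "developable I c' q' \<longleftrightarrow> (\<forall>s\<in>I. \<tau> s - R s * \<kappa> s * deriv s1 s * \<sigma> s = 0)"
proof -
  have "distribution_parameter c' q' s = 0 \<longleftrightarrow> \<tau> s - R s * \<kappa> s * deriv s1 s * \<sigma> s = 0"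
    if s: "s \<in> I" for s
  proof -
    obtain \<mu> where \<mu>: "\<mu> \<noteq> 0" "D q' s = \<mu> *\<^sub>R a s"
      using mannheim_D_director[OF phi' mannheim s] .
    have "D c' s = D c s + (R s *\<^sub>R D a s + D R s *\<^sub>R a s)"
      using phi(1,2) by (intro D_add_scaleR[OF _ s _ _ R])
        (auto simp: ruled_surface_def open_interval_def frenet_frame_def)
    then have "D c' s = 1 *\<^sub>R q s + (R s * \<kappa> s * deriv s1 s) *\<^sub>R h s + D R s *\<^sub>R a s"
      using tangent s by (simp add: D_asymptotic_normal[OF phi(1) s1 kappa s] mult_ac)
    then have "det3 (D c' s) (q' s) (D q' s)
        = \<mu> * (1 * \<tau> s - R s * \<kappa> s * deriv s1 s * \<sigma> s) * det3 (q s) (h s) (a s)"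
      unfolding \<mu>(2) q'[rule_format, OF s] by (simp only: det3_frame_combination)
    then show ?thesis
      using \<mu>(1) det3_frenet_frame_nonzero[OF phi s]
        ruled_surface_D_director_non_null[OF phi'(1) s]
      by (simp add: distribution_parameter_def)
  qed
  then show ?thesis
    by (simp add: developable_def)
qed

theorem theorem5p1:
  fixes I :: "real set"
    and c q h a c' q' h' a' :: "real \<Rightarrow> real ^ 3"
    and R \<theta> s1 \<kappa> :: "real \<Rightarrow> real"
  assumes phi: "ruled_surface I c q" "frenet_frame I q h a" "type_N_times I q h"
    and phi_developable: "developable I c q"
    and phi_param: "arc_length_param I c" "\<forall>s\<in>I. D c s = q s"
    and s1: "spherical_arc_length I q s1"
    and kappa: "conical_curvature I q h a s1 \<kappa>"
    and phi': "ruled_surface I c' q'" "frenet_frame I q' h' a'"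
    and phi'_timelike: "type_N_minus I q' h' \<or> type_N_plus I q' h'"
    and mannheim: "mannheim_offset I c a c' h'"
    and R: "smooth_on I R" "\<forall>s\<in>I. c' s = c s + R s *\<^sub>R a s"
    and theta: "offset_angle I q h q' h' a' \<theta>"
  shows "(type_N_minus I q' h' \<longrightarrow>
            (developable I c' q' \<longleftrightarrow>
              (\<forall>s\<in>I. cosh (\<theta> s) - R s * \<kappa> s * deriv s1 s * sinh (\<theta> s) = 0))) \<and>
         (type_N_plus I q' h' \<longrightarrow>
            (developable I c' q' \<longleftrightarrow>
              (\<forall>s\<in>I. sinh (\<theta> s) - R s * \<kappa> s * deriv s1 s * cosh (\<theta> s) = 0)))"
proof -
  note criterion = developable_offset_iff[OF phi phi_param(2) s1 kappa phi' mannheim R]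
  show ?thesis
  proof (intro conjI impI)
    assume "type_N_minus I q' h'"
    then show "developable I c' q' \<longleftrightarrow>
        (\<forall>s\<in>I. cosh (\<theta> s) - R s * \<kappa> s * deriv s1 s * sinh (\<theta> s) = 0)"
      using theta by (intro criterion) (simp add: offset_angle_def)
  next
    assume "type_N_plus I q' h'"
    then show "developable I c' q' \<longleftrightarrow>
        (\<forall>s\<in>I. sinh (\<theta> s) - R s * \<kappa> s * deriv s1 s * cosh (\<theta> s) = 0)"
      using theta by (intro criterion) (simp add: offset_angle_def)
  qed
qed

end
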